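(* Let $H$ be the free group on $a$ and $b$, and let $U=b^{-1}a^{-1}b^2ab^{-1}$ and $V=a$ in $H$. Then the commutator $[U,V]$ is a product of two squares in $H$, namely $$[U,V]=(ba^{-1}b^{-1}a^{-1}b^{-1}abab^{-1})^2\,(ba^{-1}b^{-1}a^{-1}b^2ab^{-1}a)^2,$$ but the equation $[x^2,y]=[U,V]$ has no solutions in $H$; that is, there are no $P,Q\in H$ with $[P^2,Q]=[U,V]$.
   Context: $[x,y]=x^{-1}y^{-1}xy$. *)

theory Defs
  imports "HOL-Algebra.Generated_Groups"
begin

text \<open>
  The free group on a set \<open>S\<close>, realised on the freely reduced words over \<open>S\<close>.
  The letter \<open>(x, True)\<close> stands for \<open>x\<close> and \<open>(x, False)\<close> for the formal inverse of \<open>x\<close>.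
\<close>

type_synonym 'a letter = "'a \<times> bool"

definition inv_letter :: "'a letter \<Rightarrow> 'a letter" where
  "inv_letter l = (fst l, \<not> snd l)"

fun reduced :: "'a letter list \<Rightarrow> bool" where
  "reduced [] \<longleftrightarrow> True"
| "reduced [l] \<longleftrightarrow> True"
| "reduced (l # m # w) \<longleftrightarrow> m \<noteq> inv_letter l \<and> reduced (m # w)"

fun cons_red :: "'a letter \<Rightarrow> 'a letter list \<Rightarrow> 'a letter list" where
  "cons_red l [] = [l]"
| "cons_red l (m # w) = (if m = inv_letter l then w else l # m # w)"

definition free_group :: "'a set \<Rightarrow> 'a letter list monoid" where
  "free_group S =
     \<lparr>carrier = {w. reduced w \<and> fst ` set w \<subseteq> S},
      mult = (\<lambda>u v. foldr cons_red u v),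
      one = []\<rparr>"

definition free_gen :: "'a \<Rightarrow> 'a letter list" where
  "free_gen x = [(x, True)]"

definition commutator :: "('g, 'm) monoid_scheme \<Rightarrow> 'g \<Rightarrow> 'g \<Rightarrow> 'g" where
  "commutator G x y = inv\<^bsub>G\<^esub> x \<otimes>\<^bsub>G\<^esub> inv\<^bsub>G\<^esub> y \<otimes>\<^bsub>G\<^esub> x \<otimes>\<^bsub>G\<^esub> y"

lemma inv_letter_inv_letter [simp]: "inv_letter (inv_letter l) = l"
  by (simp add: inv_letter_def)

lemma fst_inv_letter [simp]: "fst (inv_letter l) = fst l"
  by (simp add: inv_letter_def)

lemma inv_letter_neq [simp]: "inv_letter l \<noteq> l"
  by (cases l) (simp add: inv_letter_def)

lemma reduced_ConsD: "reduced (l # w) \<Longrightarrow> reduced w"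
  by (cases w) auto

lemma reduced_cons_red: "reduced w \<Longrightarrow> reduced (cons_red l w)"
  by (cases w) (auto dest: reduced_ConsD)

lemma reduced_foldr: "reduced v \<Longrightarrow> reduced (foldr cons_red u v)"
  by (induction u) (auto intro: reduced_cons_red)

lemma letters_cons_red: "fst ` set (cons_red l w) \<subseteq> insert (fst l) (fst ` set w)"
  by (cases w) auto

lemma letters_foldr:
  "fst ` set u \<subseteq> S \<Longrightarrow> fst ` set v \<subseteq> S \<Longrightarrow> fst ` set (foldr cons_red u v) \<subseteq> S"
proof (induction u)
  case (Cons l u)
  then have "insert (fst l) (fst ` set (foldr cons_red u v)) \<subseteq> S"
    by simp
  then show ?case
    using order_trans[OF letters_cons_red] by simp
qed simp

lemma cons_red_cancel: "reduced w \<Longrightarrow> cons_red (inv_letter l) (cons_red l w) = w"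
  by (cases w rule: reduced.cases) auto

lemma cons_red_cancel': "reduced w \<Longrightarrow> cons_red l (cons_red (inv_letter l) w) = w"
  using cons_red_cancel[of w "inv_letter l"] by simp

lemma foldr_cons_red_left:
  assumes "reduced v"
  shows "foldr cons_red (cons_red l u) v = cons_red l (foldr cons_red u v)"
  by (cases u) (auto simp: cons_red_cancel' reduced_foldr assms)

lemma foldr_cons_red_assoc:
  "reduced w \<Longrightarrow>
     foldr cons_red (foldr cons_red u v) w = foldr cons_red u (foldr cons_red v w)"
  by (induction u) (auto simp: foldr_cons_red_left)

lemma foldr_cons_red_Nil: "reduced u \<Longrightarrow> foldr cons_red u [] = u"
proof (induction u)
  case (Cons l u)
  then show ?case by (cases u) (auto dest: reduced_ConsD)
qed simp

lemma foldr_cons_red_inverse: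
  "reduced v \<Longrightarrow> foldr cons_red (rev (map inv_letter u)) (foldr cons_red u v) = v"
  by (induction u arbitrary: v) (auto simp: cons_red_cancel reduced_foldr)

lemma group_free_group: "group (free_group S)"
proof (rule groupI)
  fix u assume u: "u \<in> carrier (free_group S)"
  define v where "v = foldr cons_red (rev (map inv_letter u)) []"
  have "fst ` set v \<subseteq> S"
    using u unfolding v_def free_group_def
    by (intro letters_foldr) (simp_all add: image_image)
  moreover have "reduced v"
    by (simp add: v_def reduced_foldr)
  moreover have "foldr cons_red v u = []"
    using u foldr_cons_red_inverse[of "[]" u]
    by (simp add: v_def free_group_def foldr_cons_red_assoc foldr_cons_red_Nil)
  ultimately show "\<exists>v\<in>carrier (free_group S). v \<otimes>\<^bsub>free_group S\<^esub> u = \<one>\<^bsub>free_group S\<^esub>"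
    by (auto simp: free_group_def)
next
  fix u v assume "u \<in> carrier (free_group S)" "v \<in> carrier (free_group S)"
  then show "u \<otimes>\<^bsub>free_group S\<^esub> v \<in> carrier (free_group S)"
    by (simp add: free_group_def reduced_foldr letters_foldr)
qed (auto simp: free_group_def foldr_cons_red_assoc)

lemma free_gen_closed: "x \<in> S \<Longrightarrow> free_gen x \<in> carrier (free_group S)"
  by (simp add: free_group_def free_gen_def)

definition eval_letter :: "('g, 'm) monoid_scheme \<Rightarrow> ('a \<Rightarrow> 'g) \<Rightarrow> 'a letter \<Rightarrow> 'g" where
  "eval_letter G f l = (if snd l then f (fst l) else inv\<^bsub>G\<^esub> (f (fst l)))"

definition eval_word :: "('g, 'm) monoid_scheme \<Rightarrow> ('a \<Rightarrow> 'g) \<Rightarrow> 'a letter list \<Rightarrow> 'g" where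
  "eval_word G f w = foldr (\<lambda>l g. eval_letter G f l \<otimes>\<^bsub>G\<^esub> g) w \<one>\<^bsub>G\<^esub>"

context
  fixes G :: "('g, 'm) monoid_scheme" and S :: "'a set" and f :: "'a \<Rightarrow> 'g"
  assumes G: "group G" and f: "f ` S \<subseteq> carrier G"
begin

interpretation group G by (rule G)

lemma eval_letter_closed: "fst l \<in> S \<Longrightarrow> eval_letter G f l \<in> carrier G"
  using f by (auto simp: eval_letter_def)

lemma eval_word_closed: "fst ` set w \<subseteq> S \<Longrightarrow> eval_word G f w \<in> carrier G"
  by (induction w) (auto simp: eval_word_def eval_letter_closed)

lemma eval_letter_inv_letter:
  "fst l \<in> S \<Longrightarrow> eval_letter G f (inv_letter l) = inv\<^bsub>G\<^esub> (eval_letter G f l)"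
  using f by (auto simp: eval_letter_def inv_letter_def image_subset_iff)

lemma eval_word_cons_red:
  assumes "fst l \<in> S" "fst ` set w \<subseteq> S"
  shows "eval_word G f (cons_red l w) = eval_letter G f l \<otimes>\<^bsub>G\<^esub> eval_word G f w"
proof (cases w)
  case (Cons m v)
  have v: "eval_word G f v \<in> carrier G"
    using assms(2) Cons by (auto intro: eval_word_closed)
  show ?thesis
    using assms Cons v eval_letter_closed[of l]
    by (auto simp: eval_word_def eval_letter_inv_letter inv_solve_left m_assoc [symmetric])
qed (use assms in \<open>simp add: eval_word_def eval_letter_closed\<close>)

lemma eval_word_mult:
  "fst ` set u \<subseteq> S \<Longrightarrow> fst ` set v \<subseteq> S \<Longrightarrow>
     eval_word G f (foldr cons_red u v) = eval_word G f u \<otimes>\<^bsub>G\<^esub> eval_word G f v"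
proof (induction u)
  case Nil
  then show ?case using eval_word_closed[of v] by (simp add: eval_word_def)
next
  case (Cons l u)
  have "fst ` set (foldr cons_red u v) \<subseteq> S"
    using Cons.prems by (simp add: letters_foldr)
  moreover have "eval_word G f (l # u) = eval_letter G f l \<otimes>\<^bsub>G\<^esub> eval_word G f u"
    by (simp add: eval_word_def)
  ultimately show ?case
    using Cons eval_letter_closed[of l] eval_word_closed[of u] eval_word_closed[of v]
    by (simp add: eval_word_cons_red m_assoc)
qed

theorem free_group_universal:
  "\<exists>h \<in> hom (free_group S) G. \<forall>x\<in>S. h (free_gen x) = f x"
proof
  show "eval_word G f \<in> hom (free_group S) G"
    by (auto simp: hom_def free_group_def eval_word_mult eval_word_closed)
  show "\<forall>x\<in>S. eval_word G f (free_gen x) = f x"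
    using f by (auto simp: eval_word_def eval_letter_def free_gen_def)
qed

end

lemma free_group_generated:
  "carrier (free_group S) = generate (free_group S) (free_gen ` S)"
proof
  interpret F: group "free_group S" by (rule group_free_group)
  show "generate (free_group S) (free_gen ` S) \<subseteq> carrier (free_group S)"
    by (rule F.generate_incl) (auto intro: free_gen_closed)
  have inv_gen: "[(x, False)] = inv\<^bsub>free_group S\<^esub> (free_gen x)" if "x \<in> S" for x
    using that
    by (intro F.inv_equality [symmetric])
       (auto simp: free_group_def free_gen_def inv_letter_def)
  have letter: "[l] \<in> generate (free_group S) (free_gen ` S)" if "fst l \<in> S" for l
    using that inv_gen[of "fst l"]
    by (cases l; cases "snd l")
       (auto intro: generate.incl generate.inv simp: free_gen_def [symmetric])
  have "w \<in> generate (free_group S) (free_gen ` S)"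
    if "reduced w" "fst ` set w \<subseteq> S" for w
    using that
  proof (induction w)
    case Nil
    have "[] = \<one>\<^bsub>free_group S\<^esub>" by (simp add: free_group_def)
    then show ?case by (metis generate.one)
  next
    case (Cons l w)
    have "[l] \<otimes>\<^bsub>free_group S\<^esub> w = l # w"
      using Cons.prems by (cases w) (auto simp: free_group_def)
    then show ?case
      using Cons letter[of l] reduced_ConsD[of l w] generate.eng[of "[l]" "free_group S" _ w]
      by auto
  qed
  then show "carrier (free_group S) \<subseteq> generate (free_group S) (free_gen ` S)"
    by (auto simp: free_group_def)
qed

end

theory Submission
  imports Defs "HOL-Library.Z2" "HOL-Computational_Algebra.Formal_Laurent_Series"
begin

text \<open>
  A homomorphism from \<open>H\<close> to the affine group of a field sends \<open>a\<close> to \<open>z \<mapsto> s z\<close> and \<open>b\<close> to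
  \<open>z \<mapsto> t z + 1\<close>. If \<open>P\<close> has exponent sums \<open>m\<close> in \<open>a\<close> and \<open>n\<close> in \<open>b\<close>, its image has linear part
  \<open>s^m t^n\<close>; when this is \<open>-1\<close>, the image is an involution, so \<open>[P\<^sup>2, Q]\<close> dies. But \<open>[U, V]\<close>
  becomes the translation by \<open>(1 + 1/t) (1 - 1/s)\<^sup>2\<close>, which is nonzero for \<open>s \<noteq> 1\<close>, \<open>t \<noteq> -1\<close>.
  Suitable \<open>s\<close> and \<open>t\<close> exist over the complex numbers if \<open>m \<noteq> 0\<close> or \<open>\<bar>n\<bar> > 1\<close>, and in characteristic 2,
  where \<open>-1 = 1\<close>, if \<open>m = n = 0\<close>. In the remaining case \<open>m = 0\<close>, \<open>\<bar>n\<bar> = 1\<close>, the Heisenberg quotient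
  shows that \<open>Q\<close> has exponent sum 0 in \<open>a\<close>; then for \<open>t = 1\<close> both \<open>P\<close> and \<open>Q\<close> become translations,
  which commute.
\<close>

section \<open>Commutators, homomorphisms and inverses in free groups\<close>

lemma (in group_hom) hom_commutator:
  assumes "x \<in> carrier G" "y \<in> carrier G"
  shows "h (commutator G x y) = commutator H (h x) (h y)"
  using assms by (simp add: commutator_def)

lemma (in group) commutator_eq_one:
  assumes "x \<in> carrier G" "y \<in> carrier G" "x \<otimes> y = y \<otimes> x"
  shows "commutator G x y = \<one>"
proof -
  have "commutator G x y = inv x \<otimes> inv y \<otimes> (x \<otimes> y)"
    using assms(1,2) by (simp add: commutator_def m_assoc)
  also have "\<dots> = inv (y \<otimes> x) \<otimes> (x \<otimes> y)"
    using assms(1,2) by (simp add: inv_mult_group)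
  finally show ?thesis
    using assms by simp
qed

text \<open>The universal property only asserts existence; this explicit homomorphism can be
  computed on a given word.\<close>

lemma group_hom_eval_word:
  assumes "group G" "f ` S \<subseteq> carrier G"
  shows "group_hom (free_group S) G (eval_word G f)"
proof -
  have "eval_word G f \<in> hom (free_group S) G"
    using assms by (auto simp: hom_def free_group_def eval_word_mult eval_word_closed)
  then show ?thesis
    by (simp add: group_hom_def group_hom_axioms_def assms group_free_group)
qed

lemma inv_free_group:
  assumes "w \<in> carrier (free_group S)" "reduced (rev (map inv_letter w))"
  shows "inv\<^bsub>free_group S\<^esub> w = rev (map inv_letter w)"
proof -
  interpret group "free_group S" by (rule group_free_group)
  show ?thesis
  proof (rule inv_equality)
    show "rev (map inv_letter w) \<otimes>\<^bsub>free_group S\<^esub> w = \<one>\<^bsub>free_group S\<^esub>"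
      using assms(1) foldr_cons_red_inverse[of "[]" w]
      by (simp add: free_group_def foldr_cons_red_Nil)
  qed (use assms in \<open>auto simp: free_group_def\<close>)
qed

section \<open>Two test groups: affine maps z \<mapsto> u z + v, written \<open>(u, v)\<close>, and
  the integral Heisenberg group\<close>

definition affine_group :: "('k::field \<times> 'k) monoid" where
  "affine_group = \<lparr>carrier = {p. fst p \<noteq> 0},
     monoid.mult = (\<lambda>p q. (fst p * fst q, snd p + fst p * snd q)), one = (1, 0)\<rparr>"

lemma group_affine_group: "group affine_group"
proof (rule groupI)
  fix p :: "'a \<times> 'a" assume "p \<in> carrier affine_group"
  then show "\<exists>q\<in>carrier affine_group. q \<otimes>\<^bsub>affine_group\<^esub> p = \<one>\<^bsub>affine_group\<^esub>"
    by (intro bexI[of _ "(1 / fst p, - snd p / fst p)"]) (auto simp: affine_group_def)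
qed (auto simp: affine_group_def algebra_simps)

lemma carrier_affine_group [simp]: "(u, v) \<in> carrier affine_group \<longleftrightarrow> u \<noteq> 0"
  and mult_affine_group [simp]:
    "(u, v) \<otimes>\<^bsub>affine_group\<^esub> (u', v') = (u * u', v + u * v')"
  and one_affine_group [simp]: "\<one>\<^bsub>affine_group\<^esub> = (1, 0)"
  by (simp_all add: affine_group_def)

lemma inv_affine_group [simp]:
  "u \<noteq> 0 \<Longrightarrow> inv\<^bsub>affine_group\<^esub> (u, v) = (1 / u, - v / u)"
  by (rule group.inv_equality[OF group_affine_group]) auto

text \<open>\<open>(m, n, z)\<close> is the unitriangular 3 by 3 matrix with m, n above the diagonal
  and z in the corner.\<close>

definition heisenberg_group :: "(int \<times> int \<times> int) monoid" where
  "heisenberg_group = \<lparr>carrier = UNIV,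
     monoid.mult = (\<lambda>(m, n, z) (m', n', z'). (m + m', n + n', z + z' + m * n')), one = (0, 0, 0)\<rparr>"

lemma group_heisenberg_group: "group heisenberg_group"
proof (rule groupI)
  fix p :: "int \<times> int \<times> int"
  obtain m n z where "p = (m, n, z)" by (cases p)
  then show "\<exists>q\<in>carrier heisenberg_group. q \<otimes>\<^bsub>heisenberg_group\<^esub> p = \<one>\<^bsub>heisenberg_group\<^esub>"
    by (intro bexI[of _ "(- m, - n, m * n - z)"]) (auto simp: heisenberg_group_def)
qed (auto simp: heisenberg_group_def algebra_simps)

lemma mult_heisenberg_group [simp]:
    "(m, n, z) \<otimes>\<^bsub>heisenberg_group\<^esub> (m', n', z') = (m + m', n + n', z + z' + m * n')"
  and one_heisenberg_group [simp]: "\<one>\<^bsub>heisenberg_group\<^esub> = (0, 0, 0)"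
  and carrier_heisenberg_group [simp]: "carrier heisenberg_group = UNIV"
  by (simp_all add: heisenberg_group_def)

lemma inv_heisenberg_group [simp]:
  "inv\<^bsub>heisenberg_group\<^esub> (m, n, z) = (- m, - n, m * n - z)"
  by (rule group.inv_equality[OF group_heisenberg_group]) auto

lemma commutator_heisenberg_group:
  "commutator heisenberg_group (m, n, z) (m', n', z') = (0, 0, m * n' - n * m')"
  by (simp add: commutator_def algebra_simps)

section \<open>Exponent sums and the images of [U, V]\<close>

abbreviation affine_eval :: "'g \<Rightarrow> 'k::field \<Rightarrow> 'k \<Rightarrow> 'g letter list \<Rightarrow> 'k \<times> 'k" where
  "affine_eval x s t \<equiv> eval_word affine_group (\<lambda>z. if z = x then (s, 0) else (t, 1))"

abbreviation heisenberg_eval :: "'g \<Rightarrow> 'g letter list \<Rightarrow> int \<times> int \<times> int" where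
  "heisenberg_eval x \<equiv> eval_word heisenberg_group (\<lambda>z. if z = x then (1, 0, 0) else (0, 1, 0))"

text \<open>The linear part is multiplicative with commuting values, so only exponent sums matter;
  these are the first two Heisenberg coordinates.\<close>

lemma fst_affine_eval:
  assumes "s \<noteq> 0" "t \<noteq> 0" "heisenberg_eval x w = (m, n, z)"
  shows "fst (affine_eval x s t w) = s powi m * t powi n"
  using assms(3)
proof (induction w arbitrary: m n z)
  case Nil
  then show ?case by (auto simp: eval_word_def)
next
  case (Cons l w)
  obtain m' n' z' where w: "heisenberg_eval x w = (m', n', z')"
    by (cases "heisenberg_eval x w")
  have "heisenberg_eval x (l # w) =
      eval_letter heisenberg_group (\<lambda>z. if z = x then (1, 0, 0) else (0, 1, 0)) l
        \<otimes>\<^bsub>heisenberg_group\<^esub> (m', n', z')"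
    using w by (simp add: eval_word_def)
  then have "m = m' + (if fst l = x then if snd l then 1 else - 1 else 0)"
    and "n = n' + (if fst l = x then 0 else if snd l then 1 else - 1)"
    using Cons.prems
    by (auto simp: eval_letter_def split: if_splits)
  moreover have "fst (affine_eval x s t (l # w)) =
      fst (eval_letter affine_group (\<lambda>z. if z = x then (s, 0) else (t, 1)) l)
        * fst (affine_eval x s t w)"
    by (simp add: eval_word_def) (simp add: affine_group_def)
  ultimately show ?case
    using Cons.IH[OF w] assms(1,2)
    by (auto simp: eval_letter_def power_int_add power_int_diff power_int_minus field_simps)
qed

text \<open>This is the reduced word of [U, V], with x and y in the roles of a and b.\<close>

definition target_word :: "'g \<Rightarrow> 'g \<Rightarrow> 'g letter list" where
  "target_word x y =
     [(y, True), (x, False), (y, False), (y, False), (x, True), (y, True), (x, False),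
      (y, False), (x, False), (y, True), (y, True), (x, True), (y, False), (x, True)]"

lemma affine_eval_target_word:
  assumes "x \<noteq> y" "s \<noteq> 0" "t \<noteq> 0" "s \<noteq> 1" "t \<noteq> - 1"
  shows "affine_eval x s t (target_word x y) \<noteq> \<one>\<^bsub>affine_group\<^esub>"
proof -
  \<comment> \<open>Naming the inverses leaves a polynomial identity modulo
    \<open>s * \<sigma> = 1\<close> and \<open>t * \<tau> = 1\<close>, which \<open>algebra\<close>
    proves.\<close>
  define \<sigma> \<tau> where "\<sigma> = 1 / s" and "\<tau> = 1 / t"
  then have inverses: "s * \<sigma> = 1" "t * \<tau> = 1"
    and inv: "inv\<^bsub>affine_group\<^esub> (s, 0) = (\<sigma>, 0)" "inv\<^bsub>affine_group\<^esub> (t, 1) = (\<tau>, - \<tau>)"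
    using assms(2,3) by simp_all
  have "snd (affine_eval x s t (target_word x y)) = (1 + \<tau>) * (1 - \<sigma>)\<^sup>2"
    by (simp add: target_word_def eval_word_def eval_letter_def inv assms(1) assms(1)[symmetric]
        del: inv_affine_group) (use inverses in algebra)
  moreover have "1 + \<tau> \<noteq> 0"
    using assms(3,5) by (simp add: \<tau>_def field_simps eq_neg_iff_add_eq_0)
  moreover have "1 - \<sigma> \<noteq> 0"
    using assms(2,4) by (simp add: \<sigma>_def field_simps)
  ultimately have "snd (affine_eval x s t (target_word x y)) \<noteq> 0"
    by simp
  then show ?thesis
    by auto
qed

lemma heisenberg_eval_target_word:
  assumes "x \<noteq> y"
  shows "heisenberg_eval x (target_word x y) = (0, 0, 0)"
  using assms
  by (simp add: target_word_def eval_word_def eval_letter_def)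

section \<open>Refuting a hypothetical solution\<close>

locale solution =
  fixes x y :: 'g and P Q :: "'g letter list"
  assumes neq: "x \<noteq> y"
    and P: "P \<in> carrier (free_group {x, y})" and Q: "Q \<in> carrier (free_group {x, y})"
    and eq: "commutator (free_group {x, y}) (P [^]\<^bsub>free_group {x, y}\<^esub> (2::nat)) Q = target_word x y"
begin

text \<open>The field is fixed only in this context, so its lemmas can be used afterwards both in
  characteristic 0 and in characteristic 2.\<close>

context
  fixes s t :: "'k::field"
  assumes st: "s \<noteq> 0" "t \<noteq> 0" "s \<noteq> 1" "t \<noteq> - 1"
begin

interpretation F: group "free_group {x, y}" by (rule group_free_group)

interpretation A: group_hom "free_group {x, y}" affine_group "affine_eval x s t"
  by (rule group_hom_eval_word) (use st in \<open>auto simp: group_affine_group\<close>)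

lemma not_commute:
  defines "p \<equiv> affine_eval x s t P" and "q \<equiv> affine_eval x s t Q"
  shows "p \<otimes>\<^bsub>affine_group\<^esub> p \<otimes>\<^bsub>affine_group\<^esub> q \<noteq> q \<otimes>\<^bsub>affine_group\<^esub> (p \<otimes>\<^bsub>affine_group\<^esub> p)"
proof
  assume comm: "p \<otimes>\<^bsub>affine_group\<^esub> p \<otimes>\<^bsub>affine_group\<^esub> q = q \<otimes>\<^bsub>affine_group\<^esub> (p \<otimes>\<^bsub>affine_group\<^esub> p)"
  have pq: "p \<in> carrier affine_group" "q \<in> carrier affine_group"
    using P Q by (simp_all add: p_def q_def)
  have "affine_eval x s t (target_word x y) = commutator affine_group (p \<otimes>\<^bsub>affine_group\<^esub> p) q"
    unfolding eq [symmetric] using P Q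
    by (simp add: A.hom_commutator p_def q_def numeral_2_eq_2)
  also have "\<dots> = \<one>\<^bsub>affine_group\<^esub>"
    using comm pq by (simp add: A.H.commutator_eq_one)
  finally show False
    using affine_eval_target_word[OF neq st] by contradiction
qed

text \<open>The square of z \<mapsto> v - z is the identity, which commutes with everything.\<close>

lemma fst_P_neq: "fst (affine_eval x s t P) \<noteq> - 1"
  using not_commute by (auto simp: affine_group_def)

lemma not_both_translations:
  "\<not> (fst (affine_eval x s t P) = 1 \<and> fst (affine_eval x s t Q) = 1)"
  using not_commute by (auto simp: affine_group_def)

end

lemma inconsistent: False
proof -
  obtain m n z where hP: "heisenberg_eval x P = (m, n, z)"
    by (cases "heisenberg_eval x P")
  obtain j k z' where hQ: "heisenberg_eval x Q = (j, k, z')"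
    by (cases "heisenberg_eval x Q")
  interpret F: group "free_group {x, y}" by (rule group_free_group)
  interpret N: group_hom "free_group {x, y}" heisenberg_group "heisenberg_eval x"
    by (rule group_hom_eval_word) (auto simp: group_heisenberg_group)
  \<comment> \<open>Here [U, V] dies, so the exponent vectors of \<open>P\<^sup>2\<close> and
    \<open>Q\<close> have determinant 0.\<close>
  have "(0, 0, 0) = commutator heisenberg_group
      ((m, n, z) \<otimes>\<^bsub>heisenberg_group\<^esub> (m, n, z)) (j, k, z')"
    unfolding heisenberg_eval_target_word[OF neq, symmetric] eq [symmetric] using P Q
    by (simp add: N.hom_commutator hP hQ numeral_2_eq_2)
  also have "\<dots> = (0, 0, 2 * (m * k - n * j))"
    by (simp add: commutator_heisenberg_group algebra_simps)
  finally have det: "m * k = n * j"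
    by simp
  have root: "(cis (pi / r)) powi r = - 1" if "r \<noteq> 0" for r :: int
    using that by (simp add: cis_power_int)
  have root_neq_one: "cis (pi / r) \<noteq> 1" if "r \<noteq> 0" for r :: int
    using root[OF that] by auto
  \<comment> \<open>For |r| > 1 the angle stays strictly between -pi and pi; for |r| = 1 the root is
    -1 itself.\<close>
  have root_neq_minus_one: "cis (pi / r) \<noteq> - 1" if "\<bar>r\<bar> > 1" for r :: int
  proof
    assume "cis (pi / r) = - 1"
    then have "cos \<bar>pi / r\<bar> = cos pi"
      by (simp add: complex_eq_iff del: abs_divide)
    moreover have "\<bar>pi / r\<bar> < pi"
      using that by (simp add: abs_divide field_simps)
    ultimately show False
      using cos_inj_pi[of "\<bar>pi / r\<bar>" pi] by simp
  qed
  \<comment> \<open>The asymmetry comes from s \<noteq> 1 versus t \<noteq> -1: the chosen root of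
    -1 is always admissible as s, but as t only when |n| > 1.\<close>
  consider "m \<noteq> 0" | "m = 0" "n = 0" | "m = 0" "\<bar>n\<bar> > 1" | "m = 0" "\<bar>n\<bar> = 1"
    by linarith
  then show False
  proof cases
    case 1
    then show False
      using fst_P_neq[of "cis (pi / m)" 1] fst_affine_eval[OF _ _ hP, of "cis (pi / m)" 1]
      by (simp add: root root_neq_one)
  next
    case 2
    \<comment> \<open>The two-element field offers no s besides 0 and 1; its field of Laurent series
      does.\<close>
    let ?X = "fls_X :: bit fls"
    have minus_one: "- 1 = (1 :: bit fls)"
      by (simp add: fls_eq_iff)
    have "?X \<noteq> 1"
      by (auto simp: fls_eq_iff)
    then have "fst (affine_eval x ?X ?X P) \<noteq> 1"
      using fst_P_neq[of ?X ?X] unfolding minus_one by simp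
    then show False
      using 2 fst_affine_eval[OF _ _ hP, of ?X ?X] by simp
  next
    case 3
    then have "n \<noteq> 0" by linarith
    \<comment> \<open>As m = 0, the value of s does not affect the linear part; 2 is simply neither
      0 nor 1.\<close>
    with 3 show False
      using fst_P_neq[of 2 "cis (pi / n)"] fst_affine_eval[OF _ _ hP, of 2 "cis (pi / n)"]
        root_neq_minus_one[of n]
      by (auto simp: root)
  next
    case 4
    \<comment> \<open>With m = 0, \<open>det\<close> reads n * j = 0. The exponents n and k then
      disappear because t = 1.\<close>
    then have "j = 0" using det by auto
    then show False
      using 4 not_both_translations[of "2::complex" 1]
        fst_affine_eval[OF _ _ hP, of "2::complex" 1] fst_affine_eval[OF _ _ hQ, of "2::complex" 1]
      by simp
  qed
qed

end

theorem mainTheorem5: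
  fixes x y :: 'g and H (structure)
  defines "H \<equiv> free_group {x, y}"
  assumes "x \<noteq> y"
  fixes a b U V :: "'g letter list"
  defines "a \<equiv> free_gen x" and "b \<equiv> free_gen y"
    and "U \<equiv> inv b \<otimes> inv a \<otimes> b [^] (2::nat) \<otimes> a \<otimes> inv b"
    and "V \<equiv> a"
  shows "commutator H U V =
           (b \<otimes> inv a \<otimes> inv b \<otimes> inv a \<otimes> inv b \<otimes> a \<otimes> b \<otimes> a \<otimes> inv b) [^] (2::nat) \<otimes>
           (b \<otimes> inv a \<otimes> inv b \<otimes> inv a \<otimes> b [^] (2::nat) \<otimes> a \<otimes> inv b \<otimes> a) [^] (2::nat)
       \<and> \<not> (\<exists>P\<in>carrier H. \<exists>Q\<in>carrier H. commutator H (P [^] (2::nat)) Q = commutator H U V)"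
proof -
  interpret group H
    unfolding H_def by (rule group_free_group)
  \<comment> \<open>Identities in H become equalities of lists, checked by running the free
    reduction; x \<noteq> y decides which letters cancel.\<close>
  have mult: "u \<otimes> v = foldr cons_red u v" for u v
    by (simp add: H_def free_group_def)
  have sq: "w [^] (2::nat) = w \<otimes> w" if "reduced w" for w
    using that by (simp add: numeral_2_eq_2 H_def free_group_def foldr_cons_red_Nil)
  have ab: "a = [(x, True)]" "b = [(y, True)]"
    by (simp_all add: a_def b_def free_gen_def)
  have inv_ab: "inv a = [(x, False)]" "inv b = [(y, False)]"
    unfolding H_def ab by (subst inv_free_group; simp add: free_group_def inv_letter_def)+
  have U: "U = [(y, False), (x, False), (y, True), (y, True), (x, True), (y, False)]"
    unfolding U_def inv_ab unfolding ab
    using assms(2) by (simp add: sq mult inv_letter_def)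
  have inv_U: "inv U = [(y, True), (x, False), (y, False), (y, False), (x, True), (y, True)]"
    unfolding H_def U using assms(2)
    by (subst inv_free_group; simp add: free_group_def inv_letter_def)
  have UV: "commutator H U V = target_word x y"
    unfolding commutator_def V_def inv_U inv_ab unfolding U ab
    using assms(2) by (simp add: mult inv_letter_def target_word_def)
  have "target_word x y = 
           (b \<otimes> inv a \<otimes> inv b \<otimes> inv a \<otimes> inv b \<otimes> a \<otimes> b \<otimes> a \<otimes> inv b) [^] (2::nat) \<otimes>
           (b \<otimes> inv a \<otimes> inv b \<otimes> inv a \<otimes> b [^] (2::nat) \<otimes> a \<otimes> inv b \<otimes> a) [^] (2::nat)"
    unfolding inv_ab unfolding ab
    using assms(2) by (simp add: sq mult inv_letter_def target_word_def)
  moreover have "commutator H (P [^] (2::nat)) Q \<noteq> target_word x y"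
    if "P \<in> carrier H" "Q \<in> carrier H" for P Q
    using solution.inconsistent[of x y P Q] that assms(2) by (auto simp: solution_def H_def)
  ultimately show ?thesis
    unfolding UV by blast
qed

end
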